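(* Let $K\subset\mathbb{R}^n$ be a proper convex cone and let $f,g\in\mathrm{SL}^d(K)$. If there exist vectors $b,c\in K$ such that $D_bf=D_cg\not\equiv 0$, then $f+g$ is $K$-Lorentzian.
   Context: A convex cone $K\subset\mathbb{R}^n$ is proper if it is closed, pointed ($K\cap(-K)=\{0\}$) and has nonempty interior $\mathrm{int}\,K$. $D_af=\sum_i a_i\,\partial f/\partial x_i$. The matrix of a quadratic form $q$ is the symmetric matrix $Q$ with $q(x)=x^tQx$. A real form $f$ of degree $d\ge 2$ in $n$ variables is $K$-Lorentzian if for all $a_1,\dots,a_{d-2}\in\mathrm{int}\,K$ the matrix $Q$ of the quadratic form $q=D_{a_1}\cdots D_{a_{d-2}}f$ has exactly one positive eigenvalue and satisfies $y^tQx>0$ for all $x,y\in\mathrm{int}\,K$. For $d\le 1$ a form is $K$-Lorentzian if it is nonnegative on $K$. $\mathrm{SL}^d(K)$ is the set of $K$-Lorentzian forms of degree $d$ in $n$ variables. *)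

theory Defs
  imports "HOL-Analysis.Analysis"
begin

definition proper_convex_cone :: "(real ^ 'n) set \<Rightarrow> bool" where
  "proper_convex_cone K \<longleftrightarrow>
     convex_cone K \<and> closed K \<and> K \<inter> uminus ` K = {0} \<and> interior K \<noteq> {}"

text \<open>
  Forms are represented by their polynomial functions, which is faithful because the field
  of real numbers is infinite. Exponent vectors are functions from the index type to the
  naturals; only finitely many of them have a given total degree, so the sum is a finite one.
  The zero function is a form of every degree.
\<close>

definition is_form :: "nat \<Rightarrow> (real ^ 'n \<Rightarrow> real) \<Rightarrow> bool" where
  "is_form d f \<longleftrightarrow>
     (\<exists>c :: ('n \<Rightarrow> nat) \<Rightarrow> real.
        \<forall>x. f x = (\<Sum>\<alpha> | (\<Sum>i\<in>UNIV. \<alpha> i) = d. c \<alpha> * (\<Prod>i\<in>UNIV. (x $ i) ^ \<alpha> i)))"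

definition partial_deriv :: "'n \<Rightarrow> (real ^ 'n \<Rightarrow> real) \<Rightarrow> real ^ 'n \<Rightarrow> real" where
  "partial_deriv i f x = deriv (\<lambda>t. f (x + t *\<^sub>R axis i 1)) 0"

definition dir_deriv :: "real ^ 'n \<Rightarrow> (real ^ 'n \<Rightarrow> real) \<Rightarrow> real ^ 'n \<Rightarrow> real" where
  "dir_deriv a f = (\<lambda>x. \<Sum>i\<in>UNIV. a $ i * partial_deriv i f x)"

definition is_matrix_of_quadratic_form :: "real ^ 'n ^ 'n \<Rightarrow> (real ^ 'n \<Rightarrow> real) \<Rightarrow> bool" where
  "is_matrix_of_quadratic_form Q q \<longleftrightarrow> transpose Q = Q \<and> (\<forall>x. q x = x \<bullet> (Q *v x))"

definition eigenspace :: "real ^ 'n ^ 'n \<Rightarrow> real \<Rightarrow> (real ^ 'n) set" where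
  "eigenspace Q l = {v. Q *v v = l *\<^sub>R v}"

definition is_eigenvalue :: "real ^ 'n ^ 'n \<Rightarrow> real \<Rightarrow> bool" where
  "is_eigenvalue Q l \<longleftrightarrow> (\<exists>v. v \<noteq> 0 \<and> v \<in> eigenspace Q l)"

text \<open>
  Eigenvalues are counted with multiplicity. The geometric multiplicity is used; the matrices
  in question are symmetric, so it coincides with the algebraic one.
\<close>

definition num_positive_eigenvalues :: "real ^ 'n ^ 'n \<Rightarrow> nat" where
  "num_positive_eigenvalues Q = (\<Sum>l | l > 0 \<and> is_eigenvalue Q l. dim (eigenspace Q l))"

text \<open>
  The list \<open>as\<close> holds the directions \<open>a\<^sub>1, \<dots>, a\<^bsub>d-2\<^esub>\<close>, repetitions allowed. The matrix of a
  quadratic form exists and is unique, so the existential quantifier over \<open>Q\<close> only names it.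
\<close>

definition lorentzian :: "(real ^ 'n) set \<Rightarrow> nat \<Rightarrow> (real ^ 'n \<Rightarrow> real) \<Rightarrow> bool" where
  "lorentzian K d f \<longleftrightarrow>
     is_form d f \<and>
     (if d \<le> 1 then \<forall>x\<in>K. 0 \<le> f x
      else \<forall>as. length as = d - 2 \<and> set as \<subseteq> interior K \<longrightarrow>
        (\<exists>Q. is_matrix_of_quadratic_form Q (foldr dir_deriv as f) \<and>
             num_positive_eigenvalues Q = 1 \<and>
             (\<forall>x\<in>interior K. \<forall>y\<in>interior K. 0 < y \<bullet> (Q *v x))))"

definition SL :: "nat \<Rightarrow> (real ^ 'n) set \<Rightarrow> (real ^ 'n \<Rightarrow> real) set" where
  "SL d K = {f. lorentzian K d f}"

end

theory Submission
  imports Defs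
begin

text \<open>
  In degree at most 1 there is only nonnegativity to add up. In degree \<open>d \<ge> 2\<close> fix directions
  \<open>a\<^sub>1, \<dots>, a\<^bsub>d-2\<^esub>\<close> in the interior of \<open>K\<close> and let \<open>Q\<close> and \<open>R\<close> be the matrices of the
  quadratic forms that \<open>f\<close> and \<open>g\<close> yield. Those of \<open>f + g\<close> have the matrix \<open>Q + R\<close>, which is
  clearly positive on pairs of interior points of \<open>K\<close> and so has a positive eigenvalue. The point
  is that it has no more than one.

  Directional derivatives of polynomials commute (\<open>dir_deriv_commute\<close>). Applying the derivatives
  along the \<open>a\<^sub>i\<close> to \<open>dir_deriv b f = dir_deriv c g\<close> therefore gives an equation between the
  derivatives of the two quadratic forms, namely \<open>Q *v b = R *v c\<close>. Call this vector \<open>w\<close>. It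
  is nonzero (\<open>lorentzian_dir_deriv_nonzero\<close>): mixed derivatives of \<open>dir_deriv b f\<close> in
  directions of \<open>K\<close> are nonnegative, and a multilinear form that is nonnegative on \<open>K\<close> cannot
  vanish at an interior point without vanishing identically (\<open>mixed_deriv_zero_imp_zero\<close>).

  A symmetric matrix that has a vector of positive value has exactly one positive eigenvalue
  precisely if its quadratic form is nonpositive on some hyperplane
  (\<open>nonpos_on_hyperplane_if_one_positive_eigenvalue\<close>,
  \<open>one_positive_eigenvalue_if_nonpos_on_hyperplane\<close>). Sums of forms that are nonpositive on the
  same hyperplane are again so; but \<open>Q\<close> and \<open>R\<close> could need different hyperplanes. The common
  derivative removes this obstacle: because \<open>b\<close> has nonnegative value under \<open>Q\<close> and
  \<open>Q *v b \<noteq> 0\<close>, one may take the hyperplane orthogonal to \<open>Q *v b = w\<close> for \<open>Q\<close>, and likewise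
  the one orthogonal to \<open>R *v c = w\<close> for \<open>R\<close> (\<open>nonpos_on_hyperplane_of_image\<close>).
\<close>

section \<open>Directional derivatives of polynomial functions\<close>

lemma dir_deriv_add_dir: "dir_deriv (a + b) f x = dir_deriv a f x + dir_deriv b f x"
  by (simp add: dir_deriv_def distrib_right sum.distrib)

lemma dir_deriv_scaleR_dir: "dir_deriv (t *\<^sub>R a) f x = t * dir_deriv a f x"
  by (simp add: dir_deriv_def sum_distrib_left mult.assoc)

lemma linear_dir_deriv: "linear (\<lambda>a. dir_deriv a f x)"
  by (rule linearI) (simp_all add: dir_deriv_add_dir dir_deriv_scaleR_dir)

text \<open>The coordinatewise definition of the directional derivative agrees with the total
  derivative. This gives access to the sum, product and chain rules.\<close>

lemma has_derivative_dir_deriv: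
  fixes f :: "real ^ 'n \<Rightarrow> real"
  assumes "f differentiable (at x)"
  shows "(f has_derivative (\<lambda>a. dir_deriv a f x)) (at x)"
proof -
  obtain F where F: "(f has_derivative F) (at x)"
    using assms by (auto simp: differentiable_def)
  then have linF: "linear F"
    by (rule has_derivative_linear)
  have partial: "partial_deriv i f x = F (axis i 1)" for i
  proof -
    have line: "((\<lambda>t. x + t *\<^sub>R axis i 1) has_derivative (\<lambda>t. t *\<^sub>R axis i 1)) (at (0::real))"
      by (auto intro!: derivative_eq_intros)
    have "((\<lambda>t. f (x + t *\<^sub>R axis i 1)) has_derivative (\<lambda>t. F (t *\<^sub>R axis i 1))) (at (0::real))"
      using has_derivative_compose[OF line, of f F] F by simp
    moreover have "(\<lambda>t. F (t *\<^sub>R axis i 1)) = (*) (F (axis i 1))"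
      using linF by (auto simp: linear_cmul)
    ultimately have "((\<lambda>t. f (x + t *\<^sub>R axis i 1)) has_field_derivative F (axis i 1)) (at 0)"
      by (simp add: has_field_derivative_def)
    then show ?thesis
      by (simp add: partial_deriv_def DERIV_imp_deriv)
  qed
  have "dir_deriv a f x = F a" for a
  proof -
    have "dir_deriv a f x = (\<Sum>i\<in>UNIV. F (a $ i *s axis i 1))"
      using linF by (simp add: dir_deriv_def partial linear_cmul scalar_mult_eq_scaleR)
    also have "\<dots> = F (\<Sum>i\<in>UNIV. a $ i *s axis i 1)"
      using linF by (simp add: linear_sum)
    finally show ?thesis
      by (simp add: basis_expansion)
  qed
  then show ?thesis
    using F by simp
qed

lemma dir_deriv_eqI:
  fixes f :: "real ^ 'n \<Rightarrow> real"
  assumes "(f has_derivative F) (at x)"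
  shows "dir_deriv a f x = F a"
  using has_derivative_unique[OF has_derivative_dir_deriv assms] assms
  by (auto simp: differentiable_def dest: fun_cong)

lemma polynomial_has_derivative:
  fixes f :: "real ^ 'n \<Rightarrow> real"
  assumes "real_polynomial_function f"
  shows "(f has_derivative (\<lambda>a. dir_deriv a f x)) (at x)"
  by (rule has_derivative_dir_deriv) (rule differentiable_at_real_polynomial_function[OF assms])

lemma dir_deriv_linear:
  fixes f :: "real ^ 'n \<Rightarrow> real"
  assumes "bounded_linear f"
  shows "dir_deriv a f = (\<lambda>x. f a)"
  by (rule ext, rule dir_deriv_eqI) (rule bounded_linear_imp_has_derivative[OF assms])

lemma dir_deriv_const: "dir_deriv a (\<lambda>x. c) = (\<lambda>x. 0)"
  by (rule ext, rule dir_deriv_eqI) simp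

lemma dir_deriv_add:
  fixes f g :: "real ^ 'n \<Rightarrow> real"
  assumes "real_polynomial_function f" "real_polynomial_function g"
  shows "dir_deriv a (\<lambda>x. f x + g x) = (\<lambda>x. dir_deriv a f x + dir_deriv a g x)"
  by (rule ext, rule dir_deriv_eqI)
    (rule has_derivative_add[OF assms[THEN polynomial_has_derivative]])

lemma dir_deriv_mult:
  fixes f g :: "real ^ 'n \<Rightarrow> real"
  assumes "real_polynomial_function f" "real_polynomial_function g"
  shows "dir_deriv a (\<lambda>x. f x * g x) = (\<lambda>x. f x * dir_deriv a g x + dir_deriv a f x * g x)"
  by (rule ext, rule dir_deriv_eqI)
    (rule has_derivative_mult[OF assms[THEN polynomial_has_derivative]])

lemma polynomial_dir_deriv:
  fixes f :: "real ^ 'n \<Rightarrow> real"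
  assumes "real_polynomial_function f"
  shows "real_polynomial_function (dir_deriv a f)"
  using assms
  by induction (auto simp: dir_deriv_linear dir_deriv_const dir_deriv_add dir_deriv_mult)

lemma dir_deriv_commute:
  fixes f :: "real ^ 'n \<Rightarrow> real"
  assumes "real_polynomial_function f"
  shows "dir_deriv a (dir_deriv b f) = dir_deriv b (dir_deriv a f)"
  using assms
proof induction
  case (mult f g)
  note D = polynomial_dir_deriv[OF mult.hyps(1)] polynomial_dir_deriv[OF mult.hyps(2)]
  show ?case
    using mult D
    by (simp add: dir_deriv_mult dir_deriv_add real_polynomial_function.intros(4) algebra_simps)
qed (simp_all add: dir_deriv_linear dir_deriv_const dir_deriv_add polynomial_dir_deriv)

lemma polynomial_foldr_dir_deriv:
  fixes f :: "real ^ 'n \<Rightarrow> real"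
  assumes "real_polynomial_function f"
  shows "real_polynomial_function (foldr dir_deriv as f)"
  by (induction as) (simp_all add: assms polynomial_dir_deriv)

lemma foldr_dir_deriv_commute:
  fixes f :: "real ^ 'n \<Rightarrow> real"
  assumes "real_polynomial_function f"
  shows "foldr dir_deriv as (dir_deriv b f) = dir_deriv b (foldr dir_deriv as f)"
  by (induction as)
    (simp_all add: dir_deriv_commute[OF polynomial_foldr_dir_deriv[OF assms], of b])

lemma foldr_dir_deriv_add:
  fixes f g :: "real ^ 'n \<Rightarrow> real"
  assumes "real_polynomial_function f" "real_polynomial_function g"
  shows "foldr dir_deriv as (\<lambda>x. f x + g x) = (\<lambda>x. foldr dir_deriv as f x + foldr dir_deriv as g x)"
  by (induction as) (simp_all add: dir_deriv_add polynomial_foldr_dir_deriv assms)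

section \<open>Vanishing at interior points\<close>

text \<open>The restriction of \<open>f\<close> to the line through \<open>y\<close> and a point of \<open>U\<close> is a univariate
  polynomial with infinitely many roots.\<close>

lemma polynomial_zero_on_open:
  fixes f :: "'a::real_normed_vector \<Rightarrow> real"
  assumes f: "real_polynomial_function f" and "open U" and e: "e \<in> U"
    and zero: "\<And>x. x \<in> U \<Longrightarrow> f x = 0"
  shows "f y = 0"
proof -
  define p where "p = (\<lambda>t::real. f (e + t *\<^sub>R (y - e)))"
  have "polynomial_function (\<lambda>t::real. e + t *\<^sub>R (y - e))"
    by (intro polynomial_function_add polynomial_function_const polynomial_function_mult
        polynomial_function_id)
  then have "real_polynomial_function p"
    using real_polynomial_function_compose[of _ f] f by (simp add: p_def o_def)
  then obtain c n where c: "p = (\<lambda>t. \<Sum>i\<le>n. c i * t ^ i)"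
    by (auto simp: real_polynomial_function_iff_sum)
  have "continuous_on UNIV (\<lambda>t::real. e + t *\<^sub>R (y - e))"
    by (intro continuous_intros)
  then have "open ((\<lambda>t::real. e + t *\<^sub>R (y - e)) -` U)"
    using \<open>open U\<close> by (rule open_vimage[rotated])
  moreover have "0 \<in> (\<lambda>t::real. e + t *\<^sub>R (y - e)) -` U"
    using e by simp
  ultimately obtain r where r: "r > 0" "ball 0 r \<subseteq> (\<lambda>t::real. e + t *\<^sub>R (y - e)) -` U"
    by (meson open_contains_ball)
  have "ball 0 r \<subseteq> {t. p t = 0}"
    using r(2) zero by (auto simp: p_def)
  moreover have "infinite (ball (0::real) r)"
    using r(1) by (simp add: ball_eq_greaterThanLessThan)
  ultimately have "infinite {t. (\<Sum>i\<le>n. c i * t ^ i) = 0}"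
    unfolding c using finite_subset by blast
  then have "\<forall>i\<le>n. c i = 0"
    by (simp add: polyfun_finite_roots)
  then have "p 1 = 0"
    by (simp add: c)
  then show ?thesis
    by (simp add: p_def)
qed

text \<open>An interior zero is a local minimum of a functional that is nonnegative nearby, and a
  linear functional with a local minimum is zero.\<close>

lemma linear_nonneg_zero_interior:
  fixes L :: "'a::real_normed_vector \<Rightarrow> real"
  assumes "linear L" and "open U" and e: "e \<in> U" and "L e = 0"
    and nonneg: "\<And>x. x \<in> U \<Longrightarrow> 0 \<le> L x"
  shows "L y = 0"
proof -
  have half: "0 \<le> L z" for z
  proof -
    have "continuous_on UNIV (\<lambda>t::real. e + t *\<^sub>R z)"
      by (intro continuous_intros)
    then have "open ((\<lambda>t::real. e + t *\<^sub>R z) -` U)"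
      using \<open>open U\<close> by (rule open_vimage[rotated])
    moreover have "0 \<in> (\<lambda>t::real. e + t *\<^sub>R z) -` U"
      using e by simp
    ultimately obtain r where r: "r > 0" "ball 0 r \<subseteq> (\<lambda>t::real. e + t *\<^sub>R z) -` U"
      by (meson open_contains_ball)
    then have "e + (r / 2) *\<^sub>R z \<in> U"
      by (auto simp: subset_iff dist_norm)
    from nonneg[OF this] have "0 \<le> r / 2 * L z"
      using \<open>linear L\<close> \<open>L e = 0\<close> by (simp add: linear_add linear_cmul)
    then show ?thesis
      using \<open>r > 0\<close> by (simp add: zero_le_mult_iff)
  qed
  from half[of y] half[of "- y"] \<open>linear L\<close> show ?thesis
    by (simp add: linear_neg)
qed

text \<open>Only positive factors are used. The case \<open>t = 0\<close> would not pass directly to derivatives,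
  as it involves dividing by \<open>t\<close>.\<close>

definition pos_homogeneous :: "nat \<Rightarrow> ('a::real_vector \<Rightarrow> real) \<Rightarrow> bool" where
  "pos_homogeneous k f \<longleftrightarrow> (\<forall>t>0. \<forall>x. f (t *\<^sub>R x) = t ^ k * f x)"

text \<open>Differentiate \<open>f (t *\<^sub>R x) = t ^ k * f x\<close> in \<open>t\<close> at \<open>t = 1\<close>.\<close>

lemma euler_identity:
  fixes f :: "real ^ 'n \<Rightarrow> real"
  assumes f: "real_polynomial_function f" and hom: "pos_homogeneous k f"
  shows "dir_deriv x f x = k * f x"
proof -
  have line: "((\<lambda>t. t *\<^sub>R x) has_derivative (\<lambda>t. t *\<^sub>R x)) (at (1::real))"
    by (auto intro!: derivative_eq_intros)
  have "((\<lambda>t. f (t *\<^sub>R x)) has_derivative (\<lambda>t. dir_deriv (t *\<^sub>R x) f x)) (at (1::real))"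
    using has_derivative_compose[OF line, of f "\<lambda>a. dir_deriv a f x"]
      polynomial_has_derivative[OF f, of x] by simp
  then have "((\<lambda>t. f (t *\<^sub>R x)) has_field_derivative dir_deriv x f x) (at 1)"
    by (simp add: has_field_derivative_def dir_deriv_scaleR_dir mult.commute[of _ "dir_deriv x f x"])
  moreover have "((\<lambda>t. f (t *\<^sub>R x)) has_field_derivative k * f x) (at 1)"
  proof (rule has_field_derivative_transform_within_open[where S = "{0<..}"])
    show "((\<lambda>t. t ^ k * f x) has_field_derivative k * f x) (at 1)"
      by (auto intro!: derivative_eq_intros)
  qed (use hom in \<open>auto simp: pos_homogeneous_def\<close>)
  ultimately show ?thesis
    by (rule DERIV_unique)
qed

text \<open>Differentiate \<open>f (t *\<^sub>R x) = t ^ Suc k * f x\<close> in \<open>x\<close> and divide by \<open>t\<close>.\<close>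

lemma pos_homogeneous_dir_deriv:
  fixes f :: "real ^ 'n \<Rightarrow> real"
  assumes f: "real_polynomial_function f" and hom: "pos_homogeneous (Suc k) f"
  shows "pos_homogeneous k (dir_deriv a f)"
  unfolding pos_homogeneous_def
proof (intro allI impI)
  fix t :: real and x :: "real ^ 'n"
  assume t: "t > 0"
  have scale: "((\<lambda>x. t *\<^sub>R x) has_derivative (\<lambda>x. t *\<^sub>R x)) (at x)"
    by (auto intro!: derivative_eq_intros)
  have "((\<lambda>x. f (t *\<^sub>R x)) has_derivative (\<lambda>a. dir_deriv (t *\<^sub>R a) f (t *\<^sub>R x))) (at x)"
    by (rule has_derivative_compose[OF scale polynomial_has_derivative[OF f]])
  then have "dir_deriv a (\<lambda>x. f (t *\<^sub>R x)) x = t * dir_deriv a f (t *\<^sub>R x)"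
    by (simp add: dir_deriv_eqI dir_deriv_scaleR_dir)
  moreover have "(\<lambda>x. f (t *\<^sub>R x)) = (\<lambda>x. t ^ Suc k * f x)"
    using hom t by (auto simp: pos_homogeneous_def)
  moreover have "dir_deriv a (\<lambda>x. t ^ Suc k * f x) x = t ^ Suc k * dir_deriv a f x"
    using f by (simp add: dir_deriv_mult dir_deriv_const real_polynomial_function.intros(2))
  ultimately have "t * dir_deriv a f (t *\<^sub>R x) = t * (t ^ k * dir_deriv a f x)"
    by simp
  then show "dir_deriv a f (t *\<^sub>R x) = t ^ k * dir_deriv a f x"
    using t by simp
qed

text \<open>Iterating Euler's identity: the constant is \<open>k (k - 1) \<dots> (k - m + 1)\<close>.\<close>

lemma iterated_euler:
  fixes f :: "real ^ 'n \<Rightarrow> real"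
  assumes "real_polynomial_function f" "pos_homogeneous k f" "m \<le> k"
  shows "\<exists>C>0. foldr dir_deriv (replicate m x) f x = C * f x"
  using assms
proof (induction m arbitrary: f k)
  case 0
  show ?case
    by (rule exI[of _ 1]) simp
next
  case (Suc m)
  then obtain k' where k': "k = Suc k'" "m \<le> k'"
    by (cases k) auto
  have "foldr dir_deriv (replicate (Suc m) x) f = foldr dir_deriv (replicate m x) (dir_deriv x f)"
    using foldr_dir_deriv_commute[OF Suc.prems(1), of "replicate m x" x] by simp
  moreover obtain C where "C > 0"
    "foldr dir_deriv (replicate m x) (dir_deriv x f) x = C * dir_deriv x f x"
    using Suc.IH[of "dir_deriv x f" k'] Suc.prems k'
    by (auto simp: polynomial_dir_deriv pos_homogeneous_dir_deriv)
  ultimately show ?case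
    using Suc.prems k' by (intro exI[of _ "C * k"]) (simp add: euler_identity)
qed

text \<open>If all mixed derivatives of some order below the degree, in directions of an open set, are
  nonnegative there and one of them vanishes there, so does the form. Peeling off a direction \<open>a\<close>, induction applied
  to \<open>dir_deriv a h\<close> gives \<open>dir_deriv a h = 0\<close> on \<open>U\<close>. For fixed \<open>x\<close> the functional
  \<open>\<lambda>u. dir_deriv u h x\<close> is linear; it is nonnegative on \<open>U\<close>, because up to a positive
  constant its values are the mixed derivatives in the directions \<open>u, x, \<dots>, x\<close>. As it has
  the interior zero \<open>a\<close>, it is zero, and Euler's identity gives \<open>h x = 0\<close>.\<close>

lemma mixed_deriv_zero_imp_zero:
  fixes h :: "real ^ 'n \<Rightarrow> real"
  assumes "real_polynomial_function h" and "pos_homogeneous k h" and "length as < k"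
    and "open U" and "set as \<subseteq> U"
    and "\<And>us x. \<lbrakk>length us = length as; set us \<subseteq> U; x \<in> U\<rbrakk> \<Longrightarrow> 0 \<le> foldr dir_deriv us h x"
    and "\<And>x. x \<in> U \<Longrightarrow> foldr dir_deriv as h x = 0"
    and "x \<in> U"
  shows "h x = 0"
  using assms
proof (induction as arbitrary: h k x)
  case Nil
  then show ?case
    by simp
next
  case (Cons a as)
  note h = Cons.prems(1) and nonneg = Cons.prems(6)
  obtain k' where k': "k = Suc k'" "length as < k'"
    using Cons.prems(3) by (cases k) auto
  have D: "real_polynomial_function (dir_deriv u h)" "pos_homogeneous k' (dir_deriv u h)" for u
    using Cons.prems(2) h by (simp_all add: k'(1) polynomial_dir_deriv pos_homogeneous_dir_deriv)
  have swap: "foldr dir_deriv us (dir_deriv u h) = foldr dir_deriv (u # us) h" for u us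
    by (simp add: foldr_dir_deriv_commute h)
  have Dnonneg: "0 \<le> foldr dir_deriv us (dir_deriv u h) y"
    if "length us = length as" "set us \<subseteq> U" "u \<in> U" "y \<in> U" for us u y
    unfolding swap using that by (intro nonneg) auto
  have "dir_deriv a h x = 0"
  proof (rule Cons.IH[OF D k'(2) \<open>open U\<close>])
    show "0 \<le> foldr dir_deriv us (dir_deriv a h) y"
      if "length us = length as" "set us \<subseteq> U" "y \<in> U" for us y
      using that Cons.prems(5) by (intro Dnonneg) auto
    show "foldr dir_deriv as (dir_deriv a h) y = 0" if "y \<in> U" for y
      unfolding swap using that by (rule Cons.prems(7))
  qed (use Cons.prems(5) \<open>x \<in> U\<close> in auto)
  moreover have "0 \<le> dir_deriv u h x" if "u \<in> U" for u
  proof -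
    obtain C where "C > 0" "foldr dir_deriv (replicate (length as) x) (dir_deriv u h) x = C * dir_deriv u h x"
      using iterated_euler[OF D, of "length as"] k' by force
    moreover have "0 \<le> foldr dir_deriv (replicate (length as) x) (dir_deriv u h) x"
      using that \<open>x \<in> U\<close> by (intro Dnonneg) auto
    ultimately show ?thesis
      by (simp add: zero_le_mult_iff)
  qed
  moreover have "a \<in> U"
    using Cons.prems(5) by simp
  ultimately have "dir_deriv x h x = 0"
    using linear_nonneg_zero_interior[OF linear_dir_deriv \<open>open U\<close>] by blast
  then show ?case
    using euler_identity[OF h \<open>pos_homogeneous k h\<close>] k' by simp
qed

section \<open>Forms\<close>

lemma is_form_polynomial:
  assumes "is_form d f"
  shows "real_polynomial_function f"
proof -
  obtain c where f: "f = (\<lambda>x. \<Sum>\<alpha> | (\<Sum>i\<in>UNIV. \<alpha> i) = d. c \<alpha> * (\<Prod>i\<in>UNIV. (x $ i) ^ \<alpha> i))"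
    using assms by (auto simp: is_form_def)
  have "real_polynomial_function (\<lambda>x. c \<alpha> * (\<Prod>i\<in>UNIV. (x $ i) ^ \<alpha> i))" for \<alpha>
    by (intro real_polynomial_function.intros(4) real_polynomial_function.intros(2)
        real_polynomial_function_prod real_polynomial_function_power
        real_polynomial_function.intros(1) bounded_linear_vec_nth) simp
  then show ?thesis
    unfolding f
    by (cases "finite {\<alpha> :: 'a \<Rightarrow> nat. (\<Sum>i\<in>UNIV. \<alpha> i) = d}")
      (simp_all add: real_polynomial_function_sum real_polynomial_function.intros(2))
qed

lemma is_form_pos_homogeneous:
  assumes "is_form d f"
  shows "pos_homogeneous d f"
proof -
  obtain c where f: "f = (\<lambda>x. \<Sum>\<alpha> | (\<Sum>i\<in>UNIV. \<alpha> i) = d. c \<alpha> * (\<Prod>i\<in>UNIV. (x $ i) ^ \<alpha> i))"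
    using assms by (auto simp: is_form_def)
  show ?thesis
    unfolding pos_homogeneous_def f
    by (auto simp: sum_distrib_left power_mult_distrib prod.distrib mult_ac
        simp flip: power_sum intro!: sum.cong)
qed

lemma is_form_add:
  assumes "is_form d f" "is_form d g"
  shows "is_form d (\<lambda>x. f x + g x)"
proof -
  obtain c c' where
    "\<forall>x. f x = (\<Sum>\<alpha> | (\<Sum>i\<in>UNIV. \<alpha> i) = d. c \<alpha> * (\<Prod>i\<in>UNIV. (x $ i) ^ \<alpha> i))"
    "\<forall>x. g x = (\<Sum>\<alpha> | (\<Sum>i\<in>UNIV. \<alpha> i) = d. c' \<alpha> * (\<Prod>i\<in>UNIV. (x $ i) ^ \<alpha> i))"
    using assms by (auto simp: is_form_def)
  then show ?thesis
    unfolding is_form_def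
    by (intro exI[of _ "\<lambda>\<alpha>. c \<alpha> + c' \<alpha>"]) (simp add: sum.distrib distrib_right)
qed

section \<open>Symmetric matrices with one positive eigenvalue\<close>

lemma symmetric_matrix_inner:
  fixes Q :: "real ^ 'n ^ 'n"
  assumes "transpose Q = Q"
  shows "x \<bullet> (Q *v y) = y \<bullet> (Q *v x)"
proof -
  have "x \<bullet> (Q *v y) = (transpose Q *v x) \<bullet> y"
    by (simp add: dot_lmul_matrix transpose_matrix_vector)
  then show ?thesis
    by (simp add: assms inner_commute)
qed

lemma matrix_vector_scaleR:
  fixes Q :: "real ^ 'n ^ 'm"
  shows "Q *v (t *\<^sub>R x) = t *\<^sub>R (Q *v x)"
  by (rule linear_cmul) simp

lemma matrix_quadratic_expand:
  fixes Q :: "real ^ 'n ^ 'n"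
  assumes "transpose Q = Q"
  shows "(s *\<^sub>R x + t *\<^sub>R y) \<bullet> (Q *v (s *\<^sub>R x + t *\<^sub>R y)) =
    s\<^sup>2 * (x \<bullet> (Q *v x)) + 2 * s * t * (y \<bullet> (Q *v x)) + t\<^sup>2 * (y \<bullet> (Q *v y))"
  by (simp add: matrix_vector_right_distrib matrix_vector_scaleR inner_add_left inner_add_right
      symmetric_matrix_inner[OF assms, of x y] power2_eq_square algebra_simps)

text \<open>This is the first-order condition at a point where a quadratic function attains its
  maximal value 0; both uses below apply it along a line through such a point.\<close>

lemma linear_coeff_zero_if_nonpos:
  fixes p q :: real
  assumes "\<And>t. 2 * t * p + t\<^sup>2 * q \<le> 0"
  shows "p = 0"
proof (rule ccontr)
  assume "p \<noteq> 0"
  \<comment> \<open>A step in the direction of \<open>p\<close>, so short that the quadratic term cannot compensate.\<close>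
  define t where "t = p / (1 + \<bar>q\<bar>)"
  have p: "p = t * (1 + \<bar>q\<bar>)"
    by (simp add: t_def)
  have "2 * t * p + t\<^sup>2 * q = t\<^sup>2 * (2 + 2 * \<bar>q\<bar> + q)"
    unfolding p by (simp add: power2_eq_square algebra_simps)
  moreover have "t\<^sup>2 * (2 + 2 * \<bar>q\<bar> + q) > 0"
  proof (rule mult_pos_pos)
    show "t\<^sup>2 > 0"
      using \<open>p \<noteq> 0\<close> by (simp add: t_def)
  qed linarith
  ultimately show False
    using assms[of t] by linarith
qed

text \<open>The eigenvector is a maximizer of the Rayleigh quotient on the unit sphere of the
  subspace: at a maximizer \<open>v\<close> with value \<open>l\<close> the first variation vanishes, so
  \<open>Q *v v - l *\<^sub>R v\<close> is orthogonal to the subspace, to which it also belongs.\<close>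

lemma positive_eigenvector_in_invariant_subspace:
  fixes Q :: "real ^ 'n ^ 'n"
  assumes sym: "transpose Q = Q" and S: "subspace S"
    and inv: "\<And>x. x \<in> S \<Longrightarrow> Q *v x \<in> S"
    and u: "u \<in> S" and pos: "u \<bullet> (Q *v u) > 0"
  shows "\<exists>v\<in>S. \<exists>l>0. v \<noteq> 0 \<and> Q *v v = l *\<^sub>R v"
proof -
  have "u \<noteq> 0"
    using pos by auto
  have "compact (sphere 0 1 \<inter> S)"
    by (intro compact_Int_closed compact_sphere closed_subspace S)
  moreover have "u /\<^sub>R norm u \<in> sphere 0 1 \<inter> S"
    using \<open>u \<noteq> 0\<close> u S by (simp add: subspace_scale)
  moreover have "continuous_on (sphere 0 1 \<inter> S) (\<lambda>x. x \<bullet> (Q *v x))"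
    by (intro continuous_intros linear_continuous_on matrix_vector_mul_bounded_linear)
  ultimately obtain v where v: "v \<in> sphere 0 1 \<inter> S"
    and max: "\<And>y. y \<in> sphere 0 1 \<inter> S \<Longrightarrow> y \<bullet> (Q *v y) \<le> v \<bullet> (Q *v v)"
    using continuous_attains_sup[of "sphere 0 1 \<inter> S" "\<lambda>x. x \<bullet> (Q *v x)"] by blast
  define l where "l = v \<bullet> (Q *v v)"
  have vS: "v \<in> S" and vv: "v \<bullet> v = 1" and "v \<noteq> 0"
    using v by (auto simp: dot_square_norm)
  have le: "y \<bullet> (Q *v y) \<le> l * (y \<bullet> y)" if "y \<in> S" for y
  proof (cases "y = 0")
    case False
    then have "y /\<^sub>R norm y \<in> sphere 0 1 \<inter> S"
      using that S by (simp add: subspace_scale)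
    from max[OF this] have "(y \<bullet> (Q *v y)) / (norm y)\<^sup>2 \<le> l"
      by (simp add: l_def matrix_vector_scaleR power2_eq_square divide_inverse mult_ac)
    then show ?thesis
      using False by (simp add: divide_le_eq dot_square_norm)
  qed simp
  have "0 < l * (u \<bullet> u)"
    using pos le[OF u] by linarith
  then have "l > 0"
    using inner_ge_zero[of u] by (simp only: zero_less_mult_iff) linarith
  \<comment> \<open>Perturb the maximizer along \<open>y\<close>.\<close>
  have orth: "y \<bullet> (Q *v v) - l * (y \<bullet> v) = 0" if "y \<in> S" for y
  proof (rule linear_coeff_zero_if_nonpos)
    fix t :: real
    have "1 *\<^sub>R v + t *\<^sub>R y \<in> S"
      using vS that S by (simp add: subspace_add subspace_scale)
    from le[OF this]
    show "2 * t * (y \<bullet> (Q *v v) - l * (y \<bullet> v)) + t\<^sup>2 * (y \<bullet> (Q *v y) - l * (y \<bullet> y)) \<le> 0"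
      unfolding matrix_quadratic_expand[OF sym]
      by (simp add: l_def[symmetric] vv inner_add_left inner_add_right inner_commute[of v y]
          power2_eq_square algebra_simps)
  qed
  have "Q *v v - l *\<^sub>R v \<in> S"
    using inv[OF vS] vS S by (simp add: subspace_diff subspace_scale)
  from orth[OF this] have "(Q *v v - l *\<^sub>R v) \<bullet> (Q *v v - l *\<^sub>R v) = 0"
    by (simp add: inner_diff_right)
  then have "Q *v v = l *\<^sub>R v"
    by simp
  then show ?thesis
    using vS \<open>l > 0\<close> \<open>v \<noteq> 0\<close> by blast
qed

lemma subspace_eigenspace: "subspace (eigenspace Q l)"
  by (auto simp: eigenspace_def subspace_def matrix_vector_right_distrib matrix_vector_scaleR
      scaleR_add_right)

lemma dim_eigenspace_ge_1:
  assumes "is_eigenvalue Q l"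
  shows "1 \<le> dim (eigenspace Q l)"
  using assms by (auto simp: is_eigenvalue_def Suc_le_eq dim_eq_0 intro!: gr0I)

text \<open>If \<open>v\<close> spans the only positive eigenline, a vector of positive value orthogonal to \<open>v\<close>
  would yield a second positive eigenvector orthogonal to \<open>v\<close>, because the orthogonal
  complement of \<open>v\<close> is invariant.\<close>

lemma nonpos_on_hyperplane_if_one_positive_eigenvalue:
  fixes Q :: "real ^ 'n ^ 'n"
  assumes sym: "transpose Q = Q" and one: "num_positive_eigenvalues Q = 1"
  shows "\<exists>v. \<forall>x. v \<bullet> x = 0 \<longrightarrow> x \<bullet> (Q *v x) \<le> 0"
proof -
  define L where "L = {l. l > 0 \<and> is_eigenvalue Q l}"
  have sum1: "(\<Sum>l\<in>L. dim (eigenspace Q l)) = 1"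
    using one by (simp add: num_positive_eigenvalues_def L_def)
  then have "finite L"
    using sum.infinite by fastforce
  have "L \<noteq> {}"
    using sum1 by auto
  then obtain l where l: "l \<in> L"
    by blast
  then obtain v where v: "v \<noteq> 0" "Q *v v = l *\<^sub>R v"
    by (auto simp: L_def is_eigenvalue_def eigenspace_def)
  have "x \<bullet> (Q *v x) \<le> 0" if "v \<bullet> x = 0" for x
  proof (rule ccontr)
    assume "\<not> x \<bullet> (Q *v x) \<le> 0"
    moreover have "Q *v y \<in> {y. v \<bullet> y = 0}" if "y \<in> {y. v \<bullet> y = 0}" for y
      using that v symmetric_matrix_inner[OF sym, of v y] by (simp add: inner_commute)
    moreover have "subspace {y. v \<bullet> y = 0}"
      by (rule subspace_hyperplane)
    ultimately obtain w m where w: "v \<bullet> w = 0" "w \<noteq> 0" "m > 0" "Q *v w = m *\<^sub>R w"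
      using positive_eigenvector_in_invariant_subspace[OF sym, of "{y. v \<bullet> y = 0}" x]
        \<open>v \<bullet> x = 0\<close> by (auto simp: not_le)
    then have m: "m \<in> L"
      by (auto simp: L_def is_eigenvalue_def eigenspace_def)
    show False
    proof (cases "m = l")
      case True
      have "independent {v, w}"
        using w v pairwise_orthogonal_independent[of "{v, w}"]
        by (auto simp: pairwise_def orthogonal_def inner_commute)
      moreover have "{v, w} \<subseteq> eigenspace Q l"
        using v w True by (simp add: eigenspace_def)
      moreover have "v \<noteq> w"
        using w(1,2) by auto
      then have "card {v, w} = 2"
        by simp
      ultimately have "2 \<le> dim (eigenspace Q l)"
        using dim_subset[of "{v, w}"] dim_eq_card_independent[of "{v, w}"] by metis
      moreover have "dim (eigenspace Q l) \<le> 1"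
        using member_le_sum[OF l, of "\<lambda>l. dim (eigenspace Q l)"] \<open>finite L\<close> sum1 by simp
      ultimately show False
        by simp
    next
      case False
      have "card {l, m} \<le> card L"
        using l m \<open>finite L\<close> by (intro card_mono) auto
      also have "\<dots> \<le> (\<Sum>l\<in>L. dim (eigenspace Q l))"
        using sum_mono[of L "\<lambda>_. 1" "\<lambda>l. dim (eigenspace Q l)"] dim_eigenspace_ge_1
        by (auto simp: L_def)
      finally show False
        using False sum1 by simp
    qed
  qed
  then show ?thesis
    by blast
qed

text \<open>Conversely, two orthogonal eigenvectors with positive eigenvalues would span a plane on
  which the form is positive definite, and that plane meets every hyperplane. As eigenvectors to
  distinct eigenvalues are orthogonal, this leaves a single positive eigenvalue, and a single
  eigenline for it.\<close>

lemma one_positive_eigenvalue_if_nonpos_on_hyperplane: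
  fixes Q :: "real ^ 'n ^ 'n"
  assumes sym: "transpose Q = Q" and pos: "e \<bullet> (Q *v e) > 0"
    and w: "\<And>x. w \<bullet> x = 0 \<Longrightarrow> x \<bullet> (Q *v x) \<le> 0"
  shows "num_positive_eigenvalues Q = 1"
proof -
  have not_orthogonal: "u \<bullet> v \<noteq> 0"
    if u: "Q *v u = l *\<^sub>R u" "l > 0" "u \<noteq> 0" and v: "Q *v v = m *\<^sub>R v" "m > 0" "v \<noteq> 0" for u v l m
  proof
    assume orth: "u \<bullet> v = 0"
    \<comment> \<open>A nonzero vector of the plane spanned by \<open>u\<close> and \<open>v\<close> that lies in the hyperplane.\<close>
    obtain s t :: real where st: "s \<noteq> 0 \<or> t \<noteq> 0" "w \<bullet> (s *\<^sub>R u + t *\<^sub>R v) = 0"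
    proof (cases "w \<bullet> u = 0")
      case True
      show ?thesis
        by (rule that[of 1 0]) (simp_all add: True)
    next
      case False
      show ?thesis
        by (rule that[of "w \<bullet> v" "- (w \<bullet> u)"]) (use False in \<open>simp_all add: inner_diff_right\<close>)
    qed
    have "s\<^sup>2 * (l * (u \<bullet> u)) + t\<^sup>2 * (m * (v \<bullet> v)) \<le> 0"
      using w[OF st(2)] orth u(1) v(1)
      unfolding matrix_quadratic_expand[OF sym] by (simp add: inner_commute)
    moreover have "s\<^sup>2 * (l * (u \<bullet> u)) \<ge> 0" "t\<^sup>2 * (m * (v \<bullet> v)) \<ge> 0"
      using u v by simp_all
    ultimately have "s\<^sup>2 * (l * (u \<bullet> u)) = 0" "t\<^sup>2 * (m * (v \<bullet> v)) = 0"
      by linarith+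
    then show False
      using u v st(1) by simp
  qed
  obtain v l where v: "v \<noteq> 0" "l > 0" "Q *v v = l *\<^sub>R v"
    using positive_eigenvector_in_invariant_subspace[OF sym subspace_UNIV, of e] pos by auto
  have "m = l" if "m > 0" "is_eigenvalue Q m" for m
  proof (rule ccontr)
    assume "m \<noteq> l"
    obtain u where u: "u \<noteq> 0" "Q *v u = m *\<^sub>R u"
      using \<open>is_eigenvalue Q m\<close> by (auto simp: is_eigenvalue_def eigenspace_def)
    have "l * (u \<bullet> v) = m * (u \<bullet> v)"
      using symmetric_matrix_inner[OF sym, of u v] u v by (simp add: inner_commute)
    then show False
      using not_orthogonal[OF u(2) \<open>m > 0\<close> u(1) v(3,2,1)] \<open>m \<noteq> l\<close> by simp
  qed
  moreover have "is_eigenvalue Q l"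
    using v by (auto simp: is_eigenvalue_def eigenspace_def)
  ultimately have "{m. m > 0 \<and> is_eigenvalue Q m} = {l}"
    using v(2) by blast
  moreover have "eigenspace Q l = span {v}"
  proof (rule antisym)
    show "span {v} \<subseteq> eigenspace Q l"
      by (rule span_minimal) (use v in \<open>simp_all add: subspace_eigenspace, simp add: eigenspace_def\<close>)
    show "eigenspace Q l \<subseteq> span {v}"
    proof
      fix u
      assume u: "u \<in> eigenspace Q l"
      define r where "r = u - ((u \<bullet> v) / (v \<bullet> v)) *\<^sub>R v"
      have "r \<bullet> v = 0"
        using v by (simp add: r_def inner_diff_left)
      moreover have "r \<in> eigenspace Q l"
        unfolding r_def using u v
        by (intro subspace_diff subspace_scale subspace_eigenspace) (simp_all add: eigenspace_def)
      ultimately have "r = 0"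
        using not_orthogonal[of r l v l] v by (auto simp: eigenspace_def)
      then have "u = ((u \<bullet> v) / (v \<bullet> v)) *\<^sub>R v"
        by (simp add: r_def)
      then show "u \<in> span {v}"
        by (metis span_base span_scale insertI1)
    qed
  qed
  ultimately show ?thesis
    using v by (simp add: num_positive_eigenvalues_def)
qed

text \<open>This is the reverse Cauchy--Schwarz phenomenon, in a form that includes isotropic \<open>b\<close>.
  If \<open>x\<close> were orthogonal to \<open>Q *v b\<close> and of positive value, the form would be diagonal in
  \<open>x\<close> and \<open>b\<close>, hence nonnegative on their span. The span meets the hyperplane orthogonal
  to \<open>v\<close>, where the form is nonpositive; this is only possible if \<open>b\<close> itself lies in that
  hyperplane and is isotropic. Then \<open>b\<close> is in the kernel of the semidefinite restriction,
  and since \<open>x\<close> is orthogonal to \<open>Q *v b\<close> as well, \<open>Q *v b = 0\<close>.\<close>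

lemma nonpos_on_hyperplane_of_image:
  fixes Q :: "real ^ 'n ^ 'n"
  assumes sym: "transpose Q = Q"
    and v: "\<And>x. v \<bullet> x = 0 \<Longrightarrow> x \<bullet> (Q *v x) \<le> 0"
    and b: "b \<bullet> (Q *v b) \<ge> 0" and Qb: "Q *v b \<noteq> 0" and x: "(Q *v b) \<bullet> x = 0"
  shows "x \<bullet> (Q *v x) \<le> 0"
proof (rule ccontr)
  assume "\<not> x \<bullet> (Q *v x) \<le> 0"
  then have xpos: "x \<bullet> (Q *v x) > 0"
    by simp
  have xb: "b \<bullet> (Q *v x) = 0"
    using x symmetric_matrix_inner[OF sym, of x b] by (simp add: inner_commute)
  have vx: "v \<bullet> x \<noteq> 0"
    using v[of x] xpos by auto
  \<comment> \<open>The combination of \<open>x\<close> and \<open>b\<close> that is orthogonal to \<open>v\<close>.\<close>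
  have "v \<bullet> ((v \<bullet> b) *\<^sub>R x + (- (v \<bullet> x)) *\<^sub>R b) = 0"
    by (simp add: inner_diff_right)
  from v[OF this] have "(v \<bullet> b)\<^sup>2 * (x \<bullet> (Q *v x)) + (v \<bullet> x)\<^sup>2 * (b \<bullet> (Q *v b)) \<le> 0"
    unfolding matrix_quadratic_expand[OF sym] by (simp add: xb)
  moreover have "(v \<bullet> b)\<^sup>2 * (x \<bullet> (Q *v x)) \<ge> 0" "(v \<bullet> x)\<^sup>2 * (b \<bullet> (Q *v b)) \<ge> 0"
    using xpos b by simp_all
  ultimately have "(v \<bullet> b)\<^sup>2 * (x \<bullet> (Q *v x)) = 0" "(v \<bullet> x)\<^sup>2 * (b \<bullet> (Q *v b)) = 0"
    by linarith+
  then have vb: "v \<bullet> b = 0" and bb: "b \<bullet> (Q *v b) = 0"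
    using xpos vx by simp_all
  have tangent: "y \<bullet> (Q *v b) = 0" if "v \<bullet> y = 0" for y
  proof (rule linear_coeff_zero_if_nonpos)
    fix t :: real
    have "v \<bullet> (1 *\<^sub>R b + t *\<^sub>R y) = 0"
      using vb that by (simp add: inner_add_right)
    from v[OF this] show "2 * t * (y \<bullet> (Q *v b)) + t\<^sup>2 * (y \<bullet> (Q *v y)) \<le> 0"
      unfolding matrix_quadratic_expand[OF sym] by (simp add: bb)
  qed
  \<comment> \<open>Since \<open>v \<bullet> x \<noteq> 0\<close>, every vector is a multiple of \<open>x\<close> plus one orthogonal to \<open>v\<close>.\<close>
  have "y \<bullet> (Q *v b) = 0" for y
  proof -
    have "(y - ((v \<bullet> y) / (v \<bullet> x)) *\<^sub>R x) \<bullet> (Q *v b) = 0"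
      using vx by (intro tangent) (simp add: inner_diff_right)
    then show ?thesis
      using x by (simp add: inner_diff_left inner_commute[of x])
  qed
  then have "Q *v b = 0"
    using inner_eq_zero_iff by blast
  with Qb show False
    by contradiction
qed

section \<open>Lorentzian forms\<close>

lemma dir_deriv_quadratic_form:
  fixes Q :: "real ^ 'n ^ 'n"
  assumes "transpose Q = Q"
  shows "dir_deriv b (\<lambda>x. x \<bullet> (Q *v x)) x = 2 * (x \<bullet> (Q *v b))"
proof -
  have "((\<lambda>x. x \<bullet> (Q *v x)) has_derivative (\<lambda>b. x \<bullet> (Q *v b) + b \<bullet> (Q *v x))) (at x)"
    by (intro has_derivative_inner has_derivative_ident bounded_linear_imp_has_derivative
        matrix_vector_mul_bounded_linear)
  from dir_deriv_eqI[OF this, of b] show ?thesis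
    by (simp add: symmetric_matrix_inner[OF assms, of b x])
qed

text \<open>A convex set with interior points lies in the closure of its interior.\<close>

lemma linear_nonneg_on_cone:
  fixes K :: "(real ^ 'n) set"
  assumes K: "proper_convex_cone K" and L: "linear L"
    and nonneg: "\<And>x. x \<in> interior K \<Longrightarrow> 0 \<le> L x" and x: "x \<in> K"
  shows "0 \<le> (L x :: real)"
proof (rule continuous_ge_on_closure[of "interior K"])
  show "continuous_on (closure (interior K)) L"
    by (rule linear_continuous_on) (use L in \<open>simp add: linear_conv_bounded_linear\<close>)
  show "x \<in> closure (interior K)"
    using K x convex_closure_interior[of K]
    by (auto simp: proper_convex_cone_def convex_cone_def)
qed (rule nonneg)

lemma matrix_nonneg_on_cone:
  fixes K :: "(real ^ 'n) set" and Q :: "real ^ 'n ^ 'n"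
  assumes K: "proper_convex_cone K"
    and pos: "\<forall>x\<in>interior K. \<forall>y\<in>interior K. 0 < y \<bullet> (Q *v x)"
    and "x \<in> K" "y \<in> K"
  shows "0 \<le> y \<bullet> (Q *v x)"
proof (rule linear_nonneg_on_cone[OF K _ _ \<open>y \<in> K\<close>, of "\<lambda>y. y \<bullet> (Q *v x)"])
  fix y
  assume y: "y \<in> interior K"
  have "linear (\<lambda>x. y \<bullet> (Q *v x))"
    by (intro linearI) (simp_all add: matrix_vector_right_distrib matrix_vector_scaleR inner_add_right)
  then show "0 \<le> y \<bullet> (Q *v x)"
    using linear_nonneg_on_cone[OF K, of "\<lambda>x. y \<bullet> (Q *v x)"] pos y \<open>x \<in> K\<close>
    by (auto intro: less_imp_le)
qed (intro linearI; simp add: inner_add_left)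

lemma lorentzianD:
  assumes "lorentzian K d f" and "2 \<le> d" and "length as = d - 2" and "set as \<subseteq> interior K"
  obtains Q where "transpose Q = Q" and "foldr dir_deriv as f = (\<lambda>x. x \<bullet> (Q *v x))"
    and "num_positive_eigenvalues Q = 1"
    and "\<forall>x\<in>interior K. \<forall>y\<in>interior K. 0 < y \<bullet> (Q *v x)"
proof -
  have "\<exists>Q. is_matrix_of_quadratic_form Q (foldr dir_deriv as f) \<and>
      num_positive_eigenvalues Q = 1 \<and> (\<forall>x\<in>interior K. \<forall>y\<in>interior K. 0 < y \<bullet> (Q *v x))"
    using assms by (simp add: lorentzian_def)
  then show thesis
    using that unfolding is_matrix_of_quadratic_form_def by blast
qed

text \<open>The mixed derivatives of \<open>dir_deriv b f\<close> are nonnegative on the interior of \<open>K\<close>, because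
  \<open>b\<close> is a limit of interior points. So if one of them vanished, \<open>dir_deriv b f\<close> would
  vanish on an open set.\<close>

lemma lorentzian_dir_deriv_nonzero:
  fixes K :: "(real ^ 'n) set"
  assumes K: "proper_convex_cone K" and f: "lorentzian K d f" and d: "2 \<le> d"
    and b: "b \<in> K" and nonzero: "dir_deriv b f \<noteq> (\<lambda>x. 0)"
    and "length as = d - 2" and "set as \<subseteq> interior K"
  shows "foldr dir_deriv as (dir_deriv b f) \<noteq> (\<lambda>x. 0)"
proof
  assume zero: "foldr dir_deriv as (dir_deriv b f) = (\<lambda>x. 0)"
  have form: "is_form d f"
    using f by (simp add: lorentzian_def)
  note poly = is_form_polynomial[OF form]
  obtain k where k: "d = Suc k" "length as < k"
    using d \<open>length as = d - 2\<close> by (cases d) auto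
  have hom: "pos_homogeneous k (dir_deriv b f)"
    using is_form_pos_homogeneous[OF form] k by (simp add: pos_homogeneous_dir_deriv poly)
  have nonneg: "0 \<le> foldr dir_deriv us (dir_deriv b f) x"
    if us: "length us = length as" "set us \<subseteq> interior K" and "x \<in> interior K" for us x
  proof -
    have "length us = d - 2"
      using us(1) \<open>length as = d - 2\<close> by simp
    then obtain Q where Q: "transpose Q = Q" "foldr dir_deriv us f = (\<lambda>x. x \<bullet> (Q *v x))"
      "\<forall>x\<in>interior K. \<forall>y\<in>interior K. 0 < y \<bullet> (Q *v x)"
      by (rule lorentzianD[OF f d _ us(2)])
    have "x \<in> K"
      using \<open>x \<in> interior K\<close> interior_subset by blast
    then show ?thesis
      using matrix_nonneg_on_cone[OF K Q(3) b]
      by (simp add: foldr_dir_deriv_commute[OF poly] Q(2) dir_deriv_quadratic_form[OF Q(1)])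
  qed
  have "dir_deriv b f x = 0" if "x \<in> interior K" for x
    using mixed_deriv_zero_imp_zero[OF polynomial_dir_deriv[OF poly] hom k(2) open_interior
        \<open>set as \<subseteq> interior K\<close> nonneg _ that] zero by simp
  moreover obtain e where "e \<in> interior K"
    using K by (auto simp: proper_convex_cone_def)
  ultimately have "dir_deriv b f y = 0" for y
    using polynomial_zero_on_open[OF polynomial_dir_deriv[OF poly] open_interior] by blast
  then show False
    using nonzero by auto
qed

theorem theorem4p15:
  fixes K :: "(real ^ 'n) set" and d :: nat and f g :: "real ^ 'n \<Rightarrow> real"
  assumes "proper_convex_cone K"
    and "f \<in> SL d K" and "g \<in> SL d K"
    and "\<exists>b\<in>K. \<exists>c\<in>K. dir_deriv b f = dir_deriv c g \<and> dir_deriv b f \<noteq> (\<lambda>x. 0)"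
  shows "lorentzian K d (\<lambda>x. f x + g x)"
proof -
  note K = assms(1)
  have f: "lorentzian K d f" and g: "lorentzian K d g"
    using assms by (simp_all add: SL_def)
  then have form: "is_form d f" "is_form d g"
    by (simp_all add: lorentzian_def)
  note poly = form[THEN is_form_polynomial]
  obtain b c where b: "b \<in> K" and c: "c \<in> K" and eq: "dir_deriv b f = dir_deriv c g"
    and nonzero: "dir_deriv b f \<noteq> (\<lambda>x. 0)"
    using assms(4) by blast
  obtain e where e: "e \<in> interior K"
    using K by (auto simp: proper_convex_cone_def)
  show ?thesis
  proof (cases "d \<le> 1")
    case True
    then show ?thesis
      using f g is_form_add[OF form] by (simp add: lorentzian_def)
  next
    case False
    then have d: "2 \<le> d"
      by simp
    have "\<exists>Q. is_matrix_of_quadratic_form Q (foldr dir_deriv as (\<lambda>x. f x + g x)) \<and>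
             num_positive_eigenvalues Q = 1 \<and>
             (\<forall>x\<in>interior K. \<forall>y\<in>interior K. 0 < y \<bullet> (Q *v x))"
      if as: "length as = d - 2" "set as \<subseteq> interior K" for as
    proof -
      obtain Q where Q: "transpose Q = Q" "foldr dir_deriv as f = (\<lambda>x. x \<bullet> (Q *v x))"
        "num_positive_eigenvalues Q = 1" "\<forall>x\<in>interior K. \<forall>y\<in>interior K. 0 < y \<bullet> (Q *v x)"
        using lorentzianD[OF f d as] by blast
      obtain R where R: "transpose R = R" "foldr dir_deriv as g = (\<lambda>x. x \<bullet> (R *v x))"
        "num_positive_eigenvalues R = 1" "\<forall>x\<in>interior K. \<forall>y\<in>interior K. 0 < y \<bullet> (R *v x)"
        using lorentzianD[OF g d as] by blast
      have DQ: "foldr dir_deriv as (dir_deriv b f) x = 2 * (x \<bullet> (Q *v b))" for x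
        by (simp add: foldr_dir_deriv_commute[OF poly(1)] Q(2) dir_deriv_quadratic_form[OF Q(1)])
      have DR: "foldr dir_deriv as (dir_deriv c g) x = 2 * (x \<bullet> (R *v c))" for x
        by (simp add: foldr_dir_deriv_commute[OF poly(2)] R(2) dir_deriv_quadratic_form[OF R(1)])
      \<comment> \<open>The common derivative singles out one hyperplane for both forms, the one orthogonal to
        \<open>Q *v b = R *v c\<close>.\<close>
      have "x \<bullet> (Q *v b) = x \<bullet> (R *v c)" for x
        using DQ[of x] DR[of x] eq by simp
      then have QR: "Q *v b = R *v c"
        using vector_eq_rdot inner_commute by metis
      have Qb: "Q *v b \<noteq> 0"
        using lorentzian_dir_deriv_nonzero[OF K f d b nonzero as] DQ by auto
      have add: "(Q + R) *v x = Q *v x + R *v x" for x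
        by (rule matrix_vector_mult_add_rdistrib)
      have pos: "\<forall>x\<in>interior K. \<forall>y\<in>interior K. 0 < y \<bullet> ((Q + R) *v x)"
        using Q(4) R(4) by (simp add: add inner_add_right add_pos_pos)
      have nonpos: "x \<bullet> ((Q + R) *v x) \<le> 0" if "(Q *v b) \<bullet> x = 0" for x
      proof -
        obtain v where v: "\<And>x. v \<bullet> x = 0 \<Longrightarrow> x \<bullet> (Q *v x) \<le> 0"
          using nonpos_on_hyperplane_if_one_positive_eigenvalue[OF Q(1,3)] by blast
        obtain w where w: "\<And>x. w \<bullet> x = 0 \<Longrightarrow> x \<bullet> (R *v x) \<le> 0"
          using nonpos_on_hyperplane_if_one_positive_eigenvalue[OF R(1,3)] by blast
        have "x \<bullet> (Q *v x) \<le> 0"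
          by (rule nonpos_on_hyperplane_of_image[OF Q(1) v matrix_nonneg_on_cone[OF K Q(4) b b] Qb that])
        moreover have "x \<bullet> (R *v x) \<le> 0"
          using nonpos_on_hyperplane_of_image[OF R(1) w matrix_nonneg_on_cone[OF K R(4) c c]] Qb that
          by (simp add: QR)
        ultimately show ?thesis
          by (simp add: add inner_add_right)
      qed
      have sym: "transpose (Q + R) = Q + R"
        using Q(1) R(1) by (simp add: transpose_def vec_eq_iff)
      have "num_positive_eigenvalues (Q + R) = 1"
        by (rule one_positive_eigenvalue_if_nonpos_on_hyperplane[OF sym _ nonpos]) (use pos e in auto)
      moreover have "foldr dir_deriv as (\<lambda>x. f x + g x) = (\<lambda>x. x \<bullet> ((Q + R) *v x))"
        by (simp add: foldr_dir_deriv_add[OF poly] Q(2) R(2) add inner_add_right)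
      ultimately show ?thesis
        using sym pos unfolding is_matrix_of_quadratic_form_def by metis
    qed
    then show ?thesis
      using False is_form_add[OF form] by (simp add: lorentzian_def)
  qed
qed

end
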